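(* Let $0<q<p$, let $a$ be a real number and let $s>0$. Then $$L_{p,q}\{\cos_{p,q}(at)\}(s)=\frac{p^2s}{(ps)^2+a^2},\qquad L_{p,q}\{\sin_{p,q}(at)\}(s)=\frac{pa}{(ps)^2+a^2}.$$
   Context: Let $0<q<p$ be real numbers. For an integer $n\ge 0$, $[n]_{p,q}=\frac{p^n-q^n}{p-q}$, $[n]_{p,q}!=\prod_{k=1}^n[k]_{p,q}$ for $n\ge1$, $[0]_{p,q}!=1$. The big $(p,q)$-exponential is $E_{p,q}(z)=\sum_{n=0}^\infty\frac{q^{\binom n2}}{[n]_{p,q}!}z^n$. The $(p,q)$-cosine and $(p,q)$-sine are $\cos_{p,q}(z)=\sum_{n=0}^\infty\frac{(-1)^np^{\binom{2n}{2}}}{[2n]_{p,q}!}z^{2n}$ and $\sin_{p,q}(z)=\sum_{n=0}^\infty\frac{(-1)^np^{\binom{2n+1}{2}}}{[2n+1]_{p,q}!}z^{2n+1}$. The improper $(p,q)$-integral of $f$ on $[0,\infty)$ is $\int_0^\infty f(x)\,d_{p,q}x=(p-q)\sum_{j=-\infty}^{\infty}\frac{q^j}{p^{j+1}}f\!\left(\frac{q^j}{p^{j+1}}\right)$. The $(p,q)$-Laplace transform of the first kind of a function $f(t)$ is $L_{p,q}\{f(t)\}(s)=\int_0^\infty f(t)E_{p,q}(-qts)\,d_{p,q}t$, $s>0$.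
   Formalization: Each formula is proved whenever its Laplace sum converges absolutely (it diverges for some s>0, e.g. for most s when a=0); the (p,q)-cosine and sine are read as their analytic continuations along the real line where their series diverge. *)

theory Defs
  imports "HOL-Complex_Analysis.Complex_Analysis"
begin

definition pq_number :: "real \<Rightarrow> real \<Rightarrow> nat \<Rightarrow> real" where
  "pq_number p q n = (p ^ n - q ^ n) / (p - q)"

definition pq_fact :: "real \<Rightarrow> real \<Rightarrow> nat \<Rightarrow> real" where
  "pq_fact p q n = (\<Prod>k=1..n. pq_number p q k)"

text \<open>The big exponential: for 0 < q < p this series converges on the whole real line.\<close>

definition pq_Exp :: "real \<Rightarrow> real \<Rightarrow> real \<Rightarrow> real" where
  "pq_Exp p q z = (\<Sum>n. q ^ (n choose 2) / pq_fact p q n * z ^ n)"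

text \<open>
  For 0 < q < p the cosine and sine series converge exactly for \<bar>z\<bar> < p / (p - q), whereas the
  improper integral below samples its integrand at arbitrarily large arguments. The sums have no
  singularity on the real line: cosine and i times sine are the even and odd parts, at w = i z,
  of the meromorphic function 1 / (\<Prod>k. 1 - (1 - q/p) (q/p)^k w), whose poles are all positive.
  As usual for power series, the functions are therefore understood through analytic continuation
  along the real line. Wherever the series u converges, the value is its sum; elsewhere it is the
  value of any function analytic on the (complex) real axis that extends the sum. That value is
  unique by the identity theorem.
\<close>

definition continued_sum :: "(nat \<Rightarrow> real \<Rightarrow> real) \<Rightarrow> real \<Rightarrow> real" where
  "continued_sum u z =
     (if summable (\<lambda>n. u n z) then (\<Sum>n. u n z)
      else (THE w. \<exists>F. F analytic_on (\<real> :: complex set) \<and>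
              (\<forall>x::real. summable (\<lambda>n. u n x) \<longrightarrow> F (of_real x) = of_real (\<Sum>n. u n x)) \<and>
              F (of_real z) = of_real w))"

definition pq_cos :: "real \<Rightarrow> real \<Rightarrow> real \<Rightarrow> real" where
  "pq_cos p q =
     continued_sum (\<lambda>n z. (-1) ^ n * p ^ (2 * n choose 2) / pq_fact p q (2 * n) * z ^ (2 * n))"

definition pq_sin :: "real \<Rightarrow> real \<Rightarrow> real \<Rightarrow> real" where
  "pq_sin p q =
     continued_sum (\<lambda>n z. (-1) ^ n * p ^ ((2 * n + 1) choose 2) / pq_fact p q (2 * n + 1)
                            * z ^ (2 * n + 1))"

text \<open>
  The improper integral over [0, \<infinity>) is a sum over all integers j. Since infsum is 0 for a
  divergent sum, convergence is recorded by a separate predicate.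
\<close>

definition pq_integrable :: "real \<Rightarrow> real \<Rightarrow> (real \<Rightarrow> real) \<Rightarrow> bool" where
  "pq_integrable p q f \<longleftrightarrow>
     (\<lambda>j::int. q powi j / p powi (j + 1) * f (q powi j / p powi (j + 1))) summable_on UNIV"

definition pq_integral :: "real \<Rightarrow> real \<Rightarrow> (real \<Rightarrow> real) \<Rightarrow> real" where
  "pq_integral p q f =
     (p - q) * (\<Sum>\<^sub>\<infinity>j\<in>(UNIV::int set).
                  q powi j / p powi (j + 1) * f (q powi j / p powi (j + 1)))"

definition pq_laplace :: "real \<Rightarrow> real \<Rightarrow> (real \<Rightarrow> real) \<Rightarrow> real \<Rightarrow> real" where
  "pq_laplace p q f s = pq_integral p q (\<lambda>t. f t * pq_Exp p q (- q * t * s))"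

text \<open>
  Existence of the transform is a genuine condition, as the kernel is not small at infinity for
  every s: its values at the nodes vanish for all large nodes if (1 - q/p) s is an integer power
  of q/p, and grow superexponentially otherwise. For the cosine and (with a nonzero) the sine of
  a t, the transform at s > 0 exists iff (1 - q/p) s is an integer power of q/p or \<bar>a\<bar> > p s.
\<close>

definition pq_laplace_exists :: "real \<Rightarrow> real \<Rightarrow> (real \<Rightarrow> real) \<Rightarrow> real \<Rightarrow> bool" where
  "pq_laplace_exists p q f s \<longleftrightarrow> pq_integrable p q (\<lambda>t. f t * pq_Exp p q (- q * t * s))"

end

theory Submission
  imports Defs
begin

text \<open>
  Write E for the big exponential, extended to the complex plane. The small exponential, whose even
  and odd parts are the cosine and the sine, is 1 / E(-z) inside its disc of convergence. As E has
  no zero on the imaginary axis, cosine and sine of a real z are the real and imaginary parts of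
  1 / E(-iz). With nodes x(j) = q^j / p^(j+1), the functional equation
  E(pz) = (1 + (p - q) z) E(qz) makes the Laplace sum telescope: for
  T(j) = E(-p s x(j)) / E(-i a x(j)) the difference of T(j+1) and T(j) is
  (p - q) (s - i a / p) times the j-th term x(j) E(-q s x(j)) / E(-i a x(j)). The limit of
  T(j) is 1 for j to \<infinity>. For j to -\<infinity> it is 0: convergence of the real (or imaginary) part of
  the sum forces that part of the terms to 0, and a recurrence carries this over to the other part.
\<close>

section \<open>Sums over the integers\<close>

lemma has_sum_int_imp_LIMSEQ:
  fixes f :: "int \<Rightarrow> 'a :: {comm_monoid_add, topological_space}"
  assumes "(f has_sum S) UNIV"
  shows "(\<lambda>n. \<Sum>j\<in>{- int n..<int n}. f j) \<longlonglongrightarrow> S"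
proof -
  have "filterlim (\<lambda>n. {- int n..<int n}) (finite_subsets_at_top UNIV) sequentially"
    unfolding filterlim_finite_subsets_at_top
  proof (intro allI impI, elim conjE)
    fix X :: "int set"
    assume X: "finite X"
    \<comment> \<open>The sum of the absolute values bounds every member of \<open>X\<close>, also
      when \<open>X\<close> is empty; \<open>Suc\<close> makes the bound strict.\<close>
    define N where "N = Suc (nat (\<Sum>x\<in>X. \<bar>x\<bar>))"
    have "\<bar>x\<bar> < int N" if "x \<in> X" for x
    proof -
      have "\<bar>x\<bar> \<le> (\<Sum>x\<in>X. \<bar>x\<bar>)"
        using X that by (intro member_le_sum) auto
      then show ?thesis
        unfolding N_def by simp
    qed
    then have "X \<subseteq> {- int n..<int n}" if "n \<ge> N" for n
      using that by (force simp: abs_less_iff)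
    then show "\<forall>\<^sub>F n in sequentially. finite {- int n..<int n} \<and> X \<subseteq> {- int n..<int n} \<and> {- int n..<int n} \<subseteq> UNIV"
      by (auto simp: eventually_sequentially)
  qed
  then show ?thesis
    using assms unfolding has_sum_def by (rule filterlim_compose[rotated])
qed

lemma summable_on_int_imp_LIMSEQ_neg:
  fixes f :: "int \<Rightarrow> real"
  assumes "f summable_on UNIV"
  shows "(\<lambda>n. f (- int n)) \<longlonglongrightarrow> 0"
proof -
  have "f summable_on range (\<lambda>n. - int n)"
    using assms by (rule summable_on_subset_banach) simp
  then have "(f \<circ> (\<lambda>n. - int n)) summable_on UNIV"
    by (subst (asm) summable_on_reindex) (auto simp: inj_on_def)
  then have "summable (\<lambda>n. f (- int n))"
    using summable_on_imp_summable[of "\<lambda>n. f (- int n)"] by (simp add: o_def)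
  then show ?thesis
    by (rule summable_LIMSEQ_zero)
qed

lemma sum_int_telescope:
  fixes T :: "int \<Rightarrow> 'a :: ab_group_add"
  shows "(\<Sum>j\<in>{- int n..<int n}. T (j + 1) - T j) = T (int n) - T (- int n)"
proof (induction n)
  case (Suc n)
  have "{- int (Suc n)..<int (Suc n)} = insert (- 1 - int n) (insert (int n) {- int n..<int n})"
    by auto
  then show ?case
    by (simp add: Suc.IH algebra_simps)
qed simp

section \<open>Uniqueness of continuation along the real axis\<close>

lemma analytic_on_Reals_eqI:
  fixes F G :: "complex \<Rightarrow> complex"
  assumes F: "F analytic_on \<real>" and G: "G analytic_on \<real>" and "R > 0"
    and eq: "\<And>x::real. \<bar>x\<bar> < R \<Longrightarrow> F (of_real x) = G (of_real x)"
  shows "F (of_real z) = G (of_real z)"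
proof -
  have "(\<lambda>w. F w - G w) analytic_on \<real>"
    using F G by (rule analytic_on_diff)
  then obtain T where T: "open T" "\<real> \<subseteq> T" "(\<lambda>w. F w - G w) holomorphic_on T"
    by (auto simp: analytic_on_holomorphic)
  \<comment> \<open>The identity theorem asks for a connected domain, which \<open>T\<close> may
    fail to be. Its component of 0 contains the whole real axis, since that is connected.\<close>
  define S where "S = connected_component_set T 0"
  have "connected (\<real> :: complex set)"
    by (intro convex_connected convex_Reals)
  then have "\<real> \<subseteq> S"
    unfolding S_def using T(2) by (intro connected_component_maximal) auto
  have S: "open S" "connected S" "S \<subseteq> T"
    unfolding S_def using T(1)
    by (auto simp: open_connected_component connected_component_subset)
  \<comment> \<open>Agreement on this half-interval suffices, because it accumulates at 0, an
    interior point of \<open>S\<close>.\<close>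
  define U :: "complex set" where "U = of_real ` {0<..<R}"
  have "(0::complex) islimpt U"
    unfolding islimpt_approachable
  proof (intro allI impI)
    fix e :: real
    assume "e > 0"
    define x where "x = min (e / 2) (R / 2)"
    have x: "0 < x" "x < R" "x < e"
      using \<open>e > 0\<close> \<open>R > 0\<close> by (auto simp: x_def)
    then have "complex_of_real x \<in> U" "complex_of_real x \<noteq> 0" "dist (complex_of_real x) 0 < e"
      by (auto simp: U_def)
    then show "\<exists>x'\<in>U. x' \<noteq> 0 \<and> dist x' 0 < e" by blast
  qed
  moreover have "U \<subseteq> S" "0 \<in> S" "complex_of_real z \<in> S"
    using \<open>\<real> \<subseteq> S\<close> by (auto simp: U_def)
  moreover have "(\<lambda>w. F w - G w) holomorphic_on S"
    using T(3) S(3) by (rule holomorphic_on_subset)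
  moreover have "F w - G w = 0" if "w \<in> U" for w
    using that eq by (auto simp: U_def)
  ultimately have "F (of_real z) - G (of_real z) = 0"
    using analytic_continuation[of "\<lambda>w. F w - G w" S U 0] S by blast
  then show ?thesis by simp
qed

text \<open>Serves both branches of \<open>continued_sum\<close>. Where the series converges,
  \<open>sums\<close> gives the value. Elsewhere \<open>F\<close> is the witness for the definite
  description, and any competitor agrees with \<open>F\<close> on the interval of radius
  \<open>R\<close> and hence on the whole axis. By \<open>div\<close>, the witness only has to match
  the sum inside that interval.\<close>

lemma continued_sum_eqI:
  assumes F: "F analytic_on \<real>" and "R > 0"
    and sums: "\<And>x. \<bar>x\<bar> < R \<Longrightarrow> (\<lambda>n. u n x) sums G x"
    and div: "\<And>x. summable (\<lambda>n. u n x) \<Longrightarrow> \<bar>x\<bar> < R"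
    and FG: "\<And>x::real. F (of_real x) = of_real (G x)"
  shows "continued_sum u z = G z"
proof (cases "summable (\<lambda>n. u n z)")
  case True
  then show ?thesis
    using sums[OF div[OF True]] by (simp add: continued_sum_def sums_iff)
next
  case False
  have "(THE w. \<exists>F. F analytic_on (\<real> :: complex set) \<and>
              (\<forall>x::real. summable (\<lambda>n. u n x) \<longrightarrow> F (of_real x) = of_real (\<Sum>n. u n x)) \<and>
              F (of_real z) = of_real w) = G z"
  proof (rule the_equality)
    show "\<exists>F. F analytic_on (\<real> :: complex set) \<and>
              (\<forall>x::real. summable (\<lambda>n. u n x) \<longrightarrow> F (of_real x) = of_real (\<Sum>n. u n x)) \<and>
              F (of_real z) = of_real (G z)"
      using F FG sums div by (intro exI[of _ F]) (auto simp: sums_iff)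
  next
    fix w
    assume "\<exists>F. F analytic_on (\<real> :: complex set) \<and>
              (\<forall>x::real. summable (\<lambda>n. u n x) \<longrightarrow> F (of_real x) = of_real (\<Sum>n. u n x)) \<and>
              F (of_real z) = of_real w"
    then obtain H where H: "H analytic_on \<real>" "H (of_real z) = of_real w"
      "\<And>x::real. summable (\<lambda>n. u n x) \<Longrightarrow> H (of_real x) = of_real (\<Sum>n. u n x)"
      by blast
    have "H (of_real z) = F (of_real z)"
      using H(1) F \<open>R > 0\<close>
    proof (rule analytic_on_Reals_eqI)
      fix x :: real
      assume "\<bar>x\<bar> < R"
      then show "H (of_real x) = F (of_real x)"
        using H(3) sums FG by (auto simp: sums_iff)
    qed
    then show "w = G z"
      using H(2) FG by simp
  qed
  with False show ?thesis
    by (simp add: continued_sum_def)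
qed

section \<open>Coefficients of the two exponentials\<close>

lemma pq_fact_0 [simp]: "pq_fact p q 0 = 1"
  by (simp add: pq_fact_def)

lemma pq_fact_Suc: "pq_fact p q (Suc n) = pq_number p q (Suc n) * pq_fact p q n"
  by (simp add: pq_fact_def mult.commute)

lemma Suc_choose_two: "Suc n choose 2 = n + (n choose 2)"
  by (simp add: numeral_2_eq_2)

definition pq_Exp_coeff :: "real \<Rightarrow> real \<Rightarrow> nat \<Rightarrow> real" where
  "pq_Exp_coeff p q n = q ^ (n choose 2) / pq_fact p q n"

definition pq_cExp :: "real \<Rightarrow> real \<Rightarrow> complex \<Rightarrow> complex" where
  "pq_cExp p q z = (\<Sum>n. of_real (pq_Exp_coeff p q n) * z ^ n)"

text \<open>
  The coefficients of the small exponential, whose even and odd parts are the cosine and the sine,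
  arise from those of the big one by exchanging the roles of p and q.
\<close>

definition pq_exp_coeff :: "real \<Rightarrow> real \<Rightarrow> nat \<Rightarrow> real" where
  "pq_exp_coeff p q n = p ^ (n choose 2) / pq_fact p q n"

definition pq_cexp :: "real \<Rightarrow> real \<Rightarrow> complex \<Rightarrow> complex" where
  "pq_cexp p q z = (\<Sum>n. of_real (pq_exp_coeff p q n) * z ^ n)"

definition pq_node :: "real \<Rightarrow> real \<Rightarrow> int \<Rightarrow> real" where
  "pq_node p q j = q powi j / p powi (j + 1)"

context
  fixes p q :: real
  assumes q: "0 < q" and qp: "q < p"
begin

lemma p: "0 < p"
  using q qp by simp

text \<open>Bounds the ratio of consecutive terms of the big series by
  \<open>(q / p) ^ n * norm z\<close>, which tends to 0, so that series is entire. The upper bound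
  that follows serves the opposite purpose: divergence of the small series outside its disc.\<close>

lemma pq_number_Suc_ge: "p ^ n \<le> pq_number p q (Suc n)"
proof -
  have "q ^ n \<le> p ^ n"
    using q qp by (intro power_mono) auto
  then have "p ^ n * (p - q) \<le> p ^ Suc n - q ^ Suc n"
    using q by (simp add: algebra_simps)
  then show ?thesis
    using qp by (simp add: pq_number_def field_simps)
qed

lemma pq_number_Suc_le: "pq_number p q (Suc n) \<le> p ^ Suc n / (p - q)"
  using q qp unfolding pq_number_def by (intro divide_right_mono) auto

lemma pq_number_Suc_pos: "pq_number p q (Suc n) > 0"
  using pq_number_Suc_ge[of n] p by (meson less_le_trans zero_less_power)

lemma pq_fact_pos: "pq_fact p q n > 0"
  by (induction n) (auto simp: pq_fact_Suc pq_number_Suc_pos)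

lemma pq_Exp_coeff_Suc:
  "pq_Exp_coeff p q (Suc n) = pq_Exp_coeff p q n * (q ^ n / pq_number p q (Suc n))"
  by (simp add: pq_Exp_coeff_def pq_fact_Suc Suc_choose_two power_add mult_ac)

lemma pq_exp_coeff_Suc:
  "pq_exp_coeff p q (Suc n) = pq_exp_coeff p q n * (p ^ n / pq_number p q (Suc n))"
  by (simp add: pq_exp_coeff_def pq_fact_Suc Suc_choose_two power_add mult_ac)

lemma pq_Exp_coeff_pos: "pq_Exp_coeff p q n > 0"
  using q pq_fact_pos by (simp add: pq_Exp_coeff_def)

lemma pq_exp_coeff_pos: "pq_exp_coeff p q n > 0"
  using p pq_fact_pos by (simp add: pq_exp_coeff_def)

lemma norm_pq_Exp_term:
  "norm (of_real (pq_Exp_coeff p q n) * z ^ n :: complex) = pq_Exp_coeff p q n * norm z ^ n"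
  using pq_Exp_coeff_pos[of n] by (simp add: norm_mult norm_power)

lemma norm_pq_exp_term:
  "norm (of_real (pq_exp_coeff p q n) * z ^ n :: complex) = pq_exp_coeff p q n * norm z ^ n"
  using pq_exp_coeff_pos[of n] by (simp add: norm_mult norm_power)

text \<open>Every ratio of consecutive coefficients is at least \<open>(p - q) / p\<close>, the
  reciprocal of the radius of convergence.\<close>

lemma pq_exp_coeff_ge: "((p - q) / p) ^ n \<le> pq_exp_coeff p q n"
proof (induction n)
  case (Suc n)
  have "(p - q) / p \<le> p ^ n / pq_number p q (Suc n)"
    using pq_number_Suc_le[of n] pq_number_Suc_pos[of n] p qp by (simp add: field_simps)
  then have "((p - q) / p) ^ n * ((p - q) / p)
      \<le> pq_exp_coeff p q n * (p ^ n / pq_number p q (Suc n))"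
    using Suc p qp pq_exp_coeff_pos[of n] by (intro mult_mono) auto
  then show ?case
    by (simp add: pq_exp_coeff_Suc mult.commute)
qed (simp add: pq_exp_coeff_def binomial_eq_0)

section \<open>Convergence of the two series\<close>

lemma LIMSEQ_ratio_power: "(\<lambda>n. (q / p) ^ n) \<longlonglongrightarrow> 0"
  using p q qp by (intro LIMSEQ_realpow_zero) auto

lemma summable_pq_cExp: "summable (\<lambda>n. of_real (pq_Exp_coeff p q n) * z ^ n :: complex)"
proof -
  have "(\<lambda>n. (q / p) ^ n * norm z) \<longlonglongrightarrow> 0 * norm z"
    by (intro tendsto_intros LIMSEQ_ratio_power)
  then have "\<forall>\<^sub>F n in sequentially. (q / p) ^ n * norm z < 1 / 2"
    by (rule order_tendstoD) simp
  then obtain N where N: "\<And>n. n \<ge> N \<Longrightarrow> (q / p) ^ n * norm z < 1 / 2"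
    by (auto simp: eventually_sequentially)
  show ?thesis
  proof (rule summable_ratio_test)
    show "(1 / 2 :: real) < 1" by simp
  next
    fix n
    assume "n \<ge> N"
    have "q ^ n / pq_number p q (Suc n) \<le> q ^ n / p ^ n"
      using pq_number_Suc_ge[of n] p q by (intro divide_left_mono) (auto simp: pq_number_Suc_pos)
    then have "q ^ n / pq_number p q (Suc n) * norm z \<le> (q / p) ^ n * norm z"
      by (intro mult_right_mono) (auto simp: power_divide)
    also have "\<dots> \<le> 1 / 2"
      using N[OF \<open>n \<ge> N\<close>] by simp
    finally have "(q ^ n / pq_number p q (Suc n) * norm z) * (pq_Exp_coeff p q n * norm z ^ n)
        \<le> 1 / 2 * (pq_Exp_coeff p q n * norm z ^ n)"
      using pq_Exp_coeff_pos[of n] by (intro mult_right_mono) auto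
    then show "norm (of_real (pq_Exp_coeff p q (Suc n)) * z ^ Suc n :: complex)
        \<le> 1 / 2 * norm (of_real (pq_Exp_coeff p q n) * z ^ n :: complex)"
      unfolding norm_pq_Exp_term by (simp add: pq_Exp_coeff_Suc mult_ac)
  qed
qed

lemma summable_pq_cexp:
  assumes "norm z < p / (p - q)"
  shows "summable (\<lambda>n. of_real (pq_exp_coeff p q n) * z ^ n :: complex)"
proof -
  have z: "(p - q) / p * norm z < 1"
    using assms p qp by (simp add: field_simps)
  \<comment> \<open>Written in terms of \<open>(q / p) ^ n\<close>, the ratio of consecutive
    coefficients visibly tends to \<open>(p - q) / p\<close>.\<close>
  have eq: "p ^ n / pq_number p q (Suc n) = (p - q) / p / (1 - q / p * (q / p) ^ n)" for n
    using p qp q by (simp add: pq_number_def power_divide divide_simps)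
  have "(\<lambda>n. (p - q) / p / (1 - q / p * (q / p) ^ n) * norm z)
      \<longlonglongrightarrow> (p - q) / p / (1 - q / p * 0) * norm z"
    by (intro tendsto_intros LIMSEQ_ratio_power) simp
  then have lim: "(\<lambda>n. p ^ n / pq_number p q (Suc n) * norm z) \<longlonglongrightarrow> (p - q) / p * norm z"
    by (simp add: eq)
  obtain c where c: "(p - q) / p * norm z < c" "c < 1"
    using dense[OF z] by blast
  obtain N where N: "\<And>n. n \<ge> N \<Longrightarrow> p ^ n / pq_number p q (Suc n) * norm z < c"
    using order_tendstoD(2)[OF lim c(1)] by (auto simp: eventually_sequentially)
  show ?thesis
  proof (rule summable_ratio_test[OF c(2)])
    fix n
    assume "n \<ge> N"
    then have "(p ^ n / pq_number p q (Suc n) * norm z) * (pq_exp_coeff p q n * norm z ^ n)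
        \<le> c * (pq_exp_coeff p q n * norm z ^ n)"
      using N[of n] pq_exp_coeff_pos[of n] by (intro mult_right_mono) auto
    then show "norm (of_real (pq_exp_coeff p q (Suc n)) * z ^ Suc n :: complex)
        \<le> c * norm (of_real (pq_exp_coeff p q n) * z ^ n :: complex)"
      unfolding norm_pq_exp_term by (simp add: pq_exp_coeff_Suc mult_ac)
  qed
qed

section \<open>Functional equations and the reciprocal relation\<close>

lemma pq_cExp_of_real: "pq_cExp p q (of_real x) = of_real (pq_Exp p q x)"
proof -
  have "summable (\<lambda>n. complex_of_real (pq_Exp_coeff p q n * x ^ n))"
    using summable_pq_cExp[of "of_real x"] by simp
  then have "summable (\<lambda>n. pq_Exp_coeff p q n * x ^ n)"
    by (simp only: summable_complex_of_real)
  from suminf_of_real[OF this, where ?'a = complex] show ?thesis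
    by (simp add: pq_cExp_def pq_Exp_def pq_Exp_coeff_def)
qed

lemma pq_cExp_0 [simp]: "pq_cExp p q 0 = 1"
  using powser_zero[of "\<lambda>n. complex_of_real (pq_Exp_coeff p q n)"]
  by (simp add: pq_cExp_def pq_Exp_coeff_def binomial_eq_0)

lemma holomorphic_pq_cExp: "pq_cExp p q holomorphic_on UNIV"
proof -
  have "\<exists>D. (pq_cExp p q has_field_derivative D) (at z)" for z
    unfolding pq_cExp_def[abs_def]
    using termdiffs_strong_converges_everywhere[OF summable_pq_cExp] by blast
  then show ?thesis
    by (auto simp: holomorphic_on_def field_differentiable_def)
qed

lemma isCont_pq_cExp: "isCont (pq_cExp p q) z"
  using holomorphic_on_imp_continuous_on[OF holomorphic_pq_cExp]
  by (simp add: continuous_on_eq_continuous_at)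

text \<open>In \<open>(p * z) ^ n - (q * z) ^ n\<close> the factor \<open>p ^ n - q ^ n\<close> is
  \<open>p - q\<close> times \<open>pq_number p q n\<close>, which cancels the last factor of the
  factorial. After an index shift, what remains is \<open>(p - q) * z\<close> times the series at
  \<open>q * z\<close>.\<close>

lemma pq_cExp_scale:
  fixes z :: complex
  shows "pq_cExp p q (p * z) = (1 + (p - q) * z) * pq_cExp p q (q * z)"
proof -
  define c where "c n = complex_of_real (pq_Exp_coeff p q n)" for n
  define f where "f n = c n * (p * z) ^ n - c n * (q * z) ^ n" for n
  have f0: "f 0 = 0"
    by (simp add: f_def)
  have s: "(\<lambda>n. c n * w ^ n) sums pq_cExp p q w" for w
    using summable_pq_cExp unfolding c_def pq_cExp_def by (rule summable_sums)
  have "f sums (pq_cExp p q (p * z) - pq_cExp p q (q * z))"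
    unfolding f_def by (intro sums_diff s)
  then have "(\<lambda>n. f (Suc n)) sums (pq_cExp p q (p * z) - pq_cExp p q (q * z))"
    using sums_Suc_iff[of f] by (simp add: f0)
  moreover have "f (Suc n) = (p - q) * z * (c n * (q * z) ^ n)" for n
  proof -
    have "pq_Exp_coeff p q (Suc n) * (p ^ Suc n - q ^ Suc n) = (p - q) * (pq_Exp_coeff p q n * q ^ n)"
      using pq_number_Suc_pos[of n] qp by (simp add: pq_Exp_coeff_Suc pq_number_def field_simps)
    then have "c (Suc n) * (of_real p ^ Suc n - of_real q ^ Suc n)
        = (of_real p - of_real q) * (c n * of_real q ^ n)"
      unfolding c_def by (metis of_real_diff of_real_mult of_real_power)
    moreover have "f (Suc n) = c (Suc n) * (of_real p ^ Suc n - of_real q ^ Suc n) * z ^ Suc n"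
      by (simp add: f_def power_mult_distrib algebra_simps)
    ultimately show ?thesis
      by (simp add: power_mult_distrib mult_ac)
  qed
  moreover have "(\<lambda>n. (p - q) * z * (c n * (q * z) ^ n)) sums ((p - q) * z * pq_cExp p q (q * z))"
    by (intro sums_mult s)
  ultimately have "pq_cExp p q (p * z) - pq_cExp p q (q * z) = (p - q) * z * pq_cExp p q (q * z)"
    by (simp add: sums_unique2)
  then show ?thesis
    by (simp add: algebra_simps)
qed

lemma pq_Exp_scale: "pq_Exp p q (p * x) = (1 + (p - q) * x) * pq_Exp p q (q * x)"
proof -
  have "complex_of_real (pq_Exp p q (p * x)) = of_real ((1 + (p - q) * x) * pq_Exp p q (q * x))"
    using pq_cExp_scale[of "of_real x"] by (simp flip: pq_cExp_of_real)
  then show ?thesis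
    by (simp only: of_real_eq_iff)
qed

text \<open>The same cancellation, but the quotient of coefficients now leaves \<open>p ^ n\<close>,
  so the series at \<open>p * z\<close> remains. Of the two arguments \<open>p * z\<close> has the
  larger norm, so the hypothesis puts both into the disc of convergence.\<close>

lemma pq_cexp_scale:
  fixes z :: complex
  assumes "norm (p * z) < p / (p - q)"
  shows "pq_cexp p q (q * z) = (1 - (p - q) * z) * pq_cexp p q (p * z)"
proof -
  define c where "c n = complex_of_real (pq_exp_coeff p q n)" for n
  define f where "f n = c n * (p * z) ^ n - c n * (q * z) ^ n" for n
  have f0: "f 0 = 0"
    by (simp add: f_def)
  have s: "(\<lambda>n. c n * w ^ n) sums pq_cexp p q w" if "norm w < p / (p - q)" for w
    using summable_pq_cexp[OF that] unfolding c_def pq_cexp_def by (rule summable_sums)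
  have "norm (q * z) \<le> norm (p * z)"
    using q qp by (simp add: norm_mult mult_right_mono)
  then have sq: "norm (q * z) < p / (p - q)"
    using assms by linarith
  have "f sums (pq_cexp p q (p * z) - pq_cexp p q (q * z))"
    unfolding f_def using assms sq by (intro sums_diff s)
  then have "(\<lambda>n. f (Suc n)) sums (pq_cexp p q (p * z) - pq_cexp p q (q * z))"
    using sums_Suc_iff[of f] by (simp add: f0)
  moreover have "f (Suc n) = (p - q) * z * (c n * (p * z) ^ n)" for n
  proof -
    have "pq_exp_coeff p q (Suc n) * (p ^ Suc n - q ^ Suc n) = (p - q) * (pq_exp_coeff p q n * p ^ n)"
      using pq_number_Suc_pos[of n] qp by (simp add: pq_exp_coeff_Suc pq_number_def field_simps)
    then have "c (Suc n) * (of_real p ^ Suc n - of_real q ^ Suc n)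
        = (of_real p - of_real q) * (c n * of_real p ^ n)"
      unfolding c_def by (metis of_real_diff of_real_mult of_real_power)
    moreover have "f (Suc n) = c (Suc n) * (of_real p ^ Suc n - of_real q ^ Suc n) * z ^ Suc n"
      by (simp add: f_def power_mult_distrib algebra_simps)
    ultimately show ?thesis
      by (simp add: power_mult_distrib mult_ac)
  qed
  moreover have "(\<lambda>n. (p - q) * z * (c n * (p * z) ^ n)) sums ((p - q) * z * pq_cexp p q (p * z))"
    using assms by (intro sums_mult s)
  ultimately have "pq_cexp p q (p * z) - pq_cexp p q (q * z) = (p - q) * z * pq_cexp p q (p * z)"
    by (simp add: sums_unique2)
  then show ?thesis
    by (simp add: algebra_simps)
qed

lemma LIMSEQ_ratio_power_mult: "(\<lambda>n. complex_of_real ((q / p) ^ n) * z) \<longlonglongrightarrow> 0"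
proof -
  have "(\<lambda>n. complex_of_real ((q / p) ^ n) * z) \<longlonglongrightarrow> of_real 0 * z"
    by (intro tendsto_intros LIMSEQ_ratio_power)
  then show ?thesis by simp
qed

text \<open>
  By the two functional equations the product is invariant under scaling by q / p, so continuity
  at 0 determines it.
\<close>

lemma pq_cExp_mult_cexp:
  assumes "norm z < p / (p - q)"
  shows "pq_cExp p q (- z) * pq_cexp p q z = 1"
proof -
  define h where "h w = pq_cExp p q (- w) * pq_cexp p q w" for w
  have step: "h (of_real (q / p) * w) = h w" if "norm w < p / (p - q)" for w
  proof -
    define v where "v = w / p"
    have v: "w = p * v" "of_real (q / p) * w = q * v"
      using p by (auto simp: v_def)
    \<comment> \<open>The factor \<open>1 - (p - q) * v\<close> takes the big exponential from the
      small argument to the large one, and the small exponential the other way. Hence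
      \<open>h\<close> at either argument is this factor times
      \<open>pq_cExp p q (- (q * v)) * pq_cexp p q w\<close>.\<close>
    have "pq_cExp p q (- w) = (1 - (p - q) * v) * pq_cExp p q (- (q * v))"
      using pq_cExp_scale[of "- v"] by (simp add: v)
    moreover have "pq_cexp p q (q * v) = (1 - (p - q) * v) * pq_cexp p q w"
      using pq_cexp_scale[of v] that by (simp add: v)
    ultimately show ?thesis
      unfolding h_def v(2) by (simp add: mult_ac)
  qed
  have "h (of_real ((q / p) ^ n) * z) = h z" for n
  proof (induction n)
    case (Suc n)
    have "(q / p) ^ n * norm z \<le> 1 * norm z"
      using p q qp by (intro mult_right_mono power_le_one) auto
    moreover have "norm (of_real ((q / p) ^ n) * z) = (q / p) ^ n * norm z"
      using p q by (simp add: norm_mult norm_power norm_divide)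
    ultimately have "norm (of_real ((q / p) ^ n) * z) < p / (p - q)"
      using assms by linarith
    from step[OF this] Suc show ?case
      by (simp add: mult_ac)
  qed simp
  moreover have "isCont h 0"
  proof -
    have "isCont (\<lambda>w. pq_cExp p q (- w)) 0"
      by (rule isCont_o2[OF _ isCont_pq_cExp]) (intro continuous_intros)
    \<comment> \<open>Half the radius serves as a point of convergence away from the centre
      0.\<close>
    moreover have "isCont (pq_cexp p q) 0"
      unfolding pq_cexp_def[abs_def]
      by (rule isCont_powser[OF summable_pq_cexp[of "of_real (p / (p - q) / 2)"]])
        (use p qp in \<open>auto simp: norm_divide norm_mult field_simps simp flip: of_real_diff\<close>)
    ultimately show ?thesis
      unfolding h_def by (intro continuous_intros)
  qed
  then have "(\<lambda>n. h (of_real ((q / p) ^ n) * z)) \<longlonglongrightarrow> h 0"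
    using LIMSEQ_ratio_power_mult by (rule isCont_tendsto_compose)
  ultimately have "h z = h 0"
    by (simp add: LIMSEQ_const_iff)
  also have "h 0 = 1"
    using powser_zero[of "\<lambda>n. complex_of_real (pq_exp_coeff p q n)"]
    by (simp add: h_def pq_cexp_def pq_exp_coeff_def binomial_eq_0)
  finally show ?thesis
    by (simp add: h_def)
qed

text \<open>A zero would propagate towards 0: on the imaginary axis the factor
  \<open>1 + (p - q) * v\<close> has real part 1, so the functional equation passes the zero on to
  all \<open>(q / p) ^ n * z\<close>. By continuity the value at 0 would vanish, but it is
  1.\<close>

lemma pq_cExp_nonzero:
  assumes "Re z = 0"
  shows "pq_cExp p q z \<noteq> 0"
proof
  assume z: "pq_cExp p q z = 0"
  have "pq_cExp p q (of_real ((q / p) ^ n) * z) = 0" for n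
  proof (induction n)
    case (Suc n)
    define v where "v = of_real ((q / p) ^ n) * z / p"
    have "of_real ((q / p) ^ n) * z = p * v" "of_real ((q / p) ^ Suc n) * z = q * v"
      using p by (auto simp: v_def)
    moreover have "Re (1 + (p - q) * v) = 1"
      using assms by (simp add: v_def flip: of_real_power of_real_divide of_real_diff)
    then have "1 + (p - q) * v \<noteq> 0"
      by (metis zero_complex.simps(1) zero_neq_one)
    ultimately show ?case
      using Suc pq_cExp_scale[of v] by simp
  qed (use z in simp)
  moreover have "(\<lambda>n. pq_cExp p q (of_real ((q / p) ^ n) * z)) \<longlonglongrightarrow> pq_cExp p q 0"
    using isCont_pq_cExp LIMSEQ_ratio_power_mult by (rule isCont_tendsto_compose)
  ultimately show False
    by (simp add: LIMSEQ_const_iff)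
qed

section \<open>Cosine and sine as real and imaginary parts\<close>

lemma cnj_pq_cExp: "cnj (pq_cExp p q z) = pq_cExp p q (cnj z)"
proof -
  have "(\<lambda>n. of_real (pq_Exp_coeff p q n) * z ^ n) sums pq_cExp p q z"
    unfolding pq_cExp_def by (rule summable_sums[OF summable_pq_cExp])
  then have "(\<lambda>n. of_real (pq_Exp_coeff p q n) * cnj z ^ n) sums cnj (pq_cExp p q z)"
    by (subst (asm) sums_cnj[symmetric]) simp
  then show ?thesis
    unfolding pq_cExp_def by (simp add: sums_iff)
qed

text \<open>By \<open>pq_cExp_mult_cexp\<close> this is the small exponential at
  \<open>\<i> * z\<close> inside its disc; the reciprocal form continues it along the whole real
  axis.\<close>

definition pq_cis :: "complex \<Rightarrow> complex" where
  "pq_cis z = inverse (pq_cExp p q (- \<i> * z))"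

lemma analytic_pq_cExp_mult: "(\<lambda>z. pq_cExp p q (c * z)) analytic_on A"
proof -
  have "(pq_cExp p q \<circ> (\<lambda>z. c * z)) holomorphic_on UNIV"
    by (intro holomorphic_on_compose holomorphic_intros)
      (rule holomorphic_on_subset[OF holomorphic_pq_cExp], simp)
  then have "(\<lambda>z. pq_cExp p q (c * z)) analytic_on UNIV"
    by (simp add: analytic_on_open o_def)
  then show ?thesis
    by (rule analytic_on_subset) simp
qed

lemma analytic_pq_cis: "pq_cis analytic_on \<real>" "(\<lambda>z. pq_cis (- z)) analytic_on \<real>"
  using analytic_pq_cExp_mult[of "- \<i>"] analytic_pq_cExp_mult[of \<i>]
  by (auto simp: pq_cis_def[abs_def] pq_cExp_nonzero elim!: Reals_cases intro!: analytic_on_inverse)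

lemma pq_cis_minus: "pq_cis (- of_real x) = cnj (pq_cis (of_real x))"
  by (simp add: pq_cis_def cnj_pq_cExp)

lemma pq_cis_sums:
  assumes "\<bar>x\<bar> < p / (p - q)"
  shows "(\<lambda>n. of_real (pq_exp_coeff p q n) * (\<i> * of_real x) ^ n) sums pq_cis (of_real x)"
proof -
  have n: "norm (\<i> * complex_of_real x) < p / (p - q)"
    using assms by (simp add: norm_mult)
  have "pq_cis (of_real x) = pq_cexp p q (\<i> * of_real x)"
    using pq_cExp_mult_cexp[OF n] by (simp add: pq_cis_def inverse_unique)
  then show ?thesis
    unfolding pq_cexp_def using summable_sums[OF summable_pq_cexp[OF n]] by simp
qed

text \<open>From the radius of convergence on, the lower bound for the coefficients keeps every term
  at absolute value at least 1. The map \<open>k\<close> picks out the even indices for the cosine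
  and the odd ones for the sine.\<close>

lemma summable_pq_exp_terms_imp_less:
  assumes sm: "summable (\<lambda>n. (-1) ^ n * pq_exp_coeff p q (k n) * x ^ k n)"
  shows "\<bar>x\<bar> < p / (p - q)"
proof (rule ccontr)
  assume "\<not> ?thesis"
  then have "(p - q) / p * \<bar>x\<bar> \<ge> 1"
    using p qp by (simp add: field_simps)
  then have "1 \<le> ((p - q) / p * \<bar>x\<bar>) ^ k n" for n
    by (rule one_le_power)
  also have "((p - q) / p * \<bar>x\<bar>) ^ k n \<le> pq_exp_coeff p q (k n) * \<bar>x\<bar> ^ k n" for n
    unfolding power_mult_distrib by (intro mult_right_mono pq_exp_coeff_ge) auto
  also have "pq_exp_coeff p q (k n) * \<bar>x\<bar> ^ k n = norm ((-1) ^ n * pq_exp_coeff p q (k n) * x ^ k n)" for n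
    using pq_exp_coeff_pos[of "k n"] by (simp add: abs_mult power_abs)
  finally have "1 \<le> norm ((-1) ^ n * pq_exp_coeff p q (k n) * x ^ k n)" for n .
  moreover have "(\<lambda>n. norm ((-1) ^ n * pq_exp_coeff p q (k n) * x ^ k n)) \<longlonglongrightarrow> 0"
    using summable_LIMSEQ_zero[OF sm] by (rule tendsto_norm_zero)
  ultimately show False
    using LIMSEQ_le_const[of _ 0 1] by fastforce
qed

lemma ii_times_power_even: "(\<i> * complex_of_real x) ^ (2 * n) = of_real ((-1) ^ n * x ^ (2 * n))"
  unfolding power_mult_distrib power_mult[of \<i>] by simp

lemma ii_times_power_odd:
  "(\<i> * complex_of_real x) ^ (2 * n + 1) = \<i> * of_real ((-1) ^ n * x ^ (2 * n + 1))"
  unfolding power_add ii_times_power_even by simp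

lemma pq_cos_eq: "pq_cos p q x = Re (pq_cis (of_real x))"
  unfolding pq_cos_def
proof (rule continued_sum_eqI[where R = "p / (p - q)"])
  \<comment> \<open>\<open>Re\<close> is not analytic. On the real axis, however,
    \<open>pq_cis (- z)\<close> is the conjugate of \<open>pq_cis z\<close>, so this even part is an
    analytic function with the required values.\<close>
  show "(\<lambda>z. (pq_cis z + pq_cis (- z)) / 2) analytic_on \<real>"
    by (intro analytic_intros analytic_pq_cis) auto
  show "p / (p - q) > 0"
    using p qp by simp
  show "(pq_cis (of_real x) + pq_cis (- of_real x)) / 2 = of_real (Re (pq_cis (of_real x)))" for x
    by (simp add: pq_cis_minus complex_add_cnj)
next
  fix x :: real
  assume "\<bar>x\<bar> < p / (p - q)"
  then have "(\<lambda>n. Re (of_real (pq_exp_coeff p q n) * (\<i> * of_real x) ^ n)) sums Re (pq_cis (of_real x))"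
    by (intro sums_Re pq_cis_sums)
  \<comment> \<open>Odd powers of \<open>\<i> * of_real x\<close> are purely imaginary, so only the
    even indices contribute to the real part.\<close>
  then have "(\<lambda>n. Re (of_real (pq_exp_coeff p q (2 * n)) * (\<i> * of_real x) ^ (2 * n))) sums Re (pq_cis (of_real x))"
  proof (subst sums_mono_reindex[where g = "\<lambda>n. 2 * n" and f = "\<lambda>n. Re (of_real (pq_exp_coeff p q n) * (\<i> * of_real x) ^ n)"])
    fix n :: nat
    assume "n \<notin> range (\<lambda>n. 2 * n)"
    then have "odd n" by auto
    then obtain m where "n = 2 * m + 1" by (rule oddE)
    then show "Re (of_real (pq_exp_coeff p q n) * (\<i> * of_real x) ^ n) = 0"
      by (simp only: ii_times_power_odd) simp
  qed (auto simp: strict_mono_def)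
  moreover have "Re (of_real (pq_exp_coeff p q (2 * n)) * (\<i> * of_real x) ^ (2 * n))
      = (-1) ^ n * p ^ (2 * n choose 2) / pq_fact p q (2 * n) * x ^ (2 * n)" for n
    unfolding ii_times_power_even by (simp add: pq_exp_coeff_def)
  ultimately show "(\<lambda>n. (-1) ^ n * p ^ (2 * n choose 2) / pq_fact p q (2 * n) * x ^ (2 * n)) sums Re (pq_cis (of_real x))"
    by simp
next
  fix x :: real
  assume "summable (\<lambda>n. (-1) ^ n * p ^ (2 * n choose 2) / pq_fact p q (2 * n) * x ^ (2 * n))"
  then show "\<bar>x\<bar> < p / (p - q)"
    by (intro summable_pq_exp_terms_imp_less[where k = "\<lambda>n. 2 * n"]) (simp add: pq_exp_coeff_def)
qed

lemma pq_sin_eq: "pq_sin p q x = Im (pq_cis (of_real x))"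
  unfolding pq_sin_def
proof (rule continued_sum_eqI[where R = "p / (p - q)"])
  \<comment> \<open>Likewise the odd part divided by \<open>\<i>\<close> replaces \<open>Im\<close>
    by an analytic function.\<close>
  show "(\<lambda>z. (pq_cis z - pq_cis (- z)) / (2 * \<i>)) analytic_on \<real>"
    by (intro analytic_intros analytic_pq_cis) auto
  show "p / (p - q) > 0"
    using p qp by simp
  show "(pq_cis (of_real x) - pq_cis (- of_real x)) / (2 * \<i>) = of_real (Im (pq_cis (of_real x)))" for x
    by (simp add: pq_cis_minus complex_eq_iff)
next
  fix x :: real
  assume "\<bar>x\<bar> < p / (p - q)"
  then have "(\<lambda>n. Im (of_real (pq_exp_coeff p q n) * (\<i> * of_real x) ^ n)) sums Im (pq_cis (of_real x))"
    by (intro sums_Im pq_cis_sums)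
  then have "(\<lambda>n. Im (of_real (pq_exp_coeff p q (2 * n + 1)) * (\<i> * of_real x) ^ (2 * n + 1))) sums Im (pq_cis (of_real x))"
  proof (subst sums_mono_reindex[where g = "\<lambda>n. 2 * n + 1" and f = "\<lambda>n. Im (of_real (pq_exp_coeff p q n) * (\<i> * of_real x) ^ n)"])
    fix n :: nat
    assume "n \<notin> range (\<lambda>n. 2 * n + 1)"
    then have "even n" by (metis oddE rangeI)
    then obtain m where "n = 2 * m" by (rule evenE)
    then show "Im (of_real (pq_exp_coeff p q n) * (\<i> * of_real x) ^ n) = 0"
      by (simp only: ii_times_power_even) simp
  qed (auto simp: strict_mono_def)
  moreover have "Im (of_real (pq_exp_coeff p q (2 * n + 1)) * (\<i> * of_real x) ^ (2 * n + 1))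
      = (-1) ^ n * p ^ ((2 * n + 1) choose 2) / pq_fact p q (2 * n + 1) * x ^ (2 * n + 1)" for n
    unfolding ii_times_power_odd by (simp add: pq_exp_coeff_def)
  ultimately show "(\<lambda>n. (-1) ^ n * p ^ ((2 * n + 1) choose 2) / pq_fact p q (2 * n + 1) * x ^ (2 * n + 1)) sums Im (pq_cis (of_real x))"
    by simp
next
  fix x :: real
  assume "summable (\<lambda>n. (-1) ^ n * p ^ ((2 * n + 1) choose 2) / pq_fact p q (2 * n + 1) * x ^ (2 * n + 1))"
  then show "\<bar>x\<bar> < p / (p - q)"
    by (intro summable_pq_exp_terms_imp_less[where k = "\<lambda>n. 2 * n + 1"]) (simp add: pq_exp_coeff_def)
qed

section \<open>Nodes and telescoping of the Laplace sum\<close>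

lemma pq_node_pos: "pq_node p q j > 0"
  using p q by (simp add: pq_node_def)

lemma pq_node_Suc: "p * pq_node p q (j + 1) = q * pq_node p q j"
  using p q by (simp add: pq_node_def power_int_add power2_eq_square field_simps)

lemma LIMSEQ_pq_node: "(\<lambda>n. pq_node p q (int n)) \<longlonglongrightarrow> 0"
proof -
  have "pq_node p q (int n) = (q / p) ^ n * (1 / p)" for n
    using p by (simp add: pq_node_def power_int_add power_divide)
  then show ?thesis
    using tendsto_mult_right[OF LIMSEQ_ratio_power, of "1 / p"] by simp
qed

lemma LIMSEQ_inverse_pq_node: "(\<lambda>n. 1 / pq_node p q (- int n)) \<longlonglongrightarrow> 0"
proof -
  have "1 / pq_node p q (- int n) = (q / p) ^ n * p" for n
    using p q by (simp add: pq_node_def power_int_add power_int_diff power_int_minus field_simps)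
  then show ?thesis
    using tendsto_mult_right[OF LIMSEQ_ratio_power, of p] by simp
qed

text \<open>One complex term handles both transforms: its real part is the summand for the cosine,
  its imaginary part the one for the sine.\<close>

definition laplace_term :: "real \<Rightarrow> real \<Rightarrow> int \<Rightarrow> complex" where
  "laplace_term a s j = of_real (pq_node p q j) *
     (pq_cis (of_real (a * pq_node p q j)) * of_real (pq_Exp p q (- q * pq_node p q j * s)))"

definition laplace_primitive :: "real \<Rightarrow> real \<Rightarrow> int \<Rightarrow> complex" where
  "laplace_primitive a s j =
     pq_cis (of_real (a * pq_node p q j)) * of_real (pq_Exp p q (- p * pq_node p q j * s))"

text \<open>Here the functional equation is applied to the kernel, at the same node. Together with
  the next lemma, which applies it to the denominator of \<open>pq_cis\<close>, it writes
  neighbouring values of the primitive as multiples of one term; \<open>1 / pq_node p q j\<close>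
  cancels in their difference.\<close>

lemma laplace_primitive_eq:
  "laplace_primitive a s j = (of_real (1 / pq_node p q j) - of_real ((p - q) * s)) * laplace_term a s j"
proof -
  define x where "x = pq_node p q j"
  have "pq_Exp p q (- p * x * s) = (1 - (p - q) * s * x) * pq_Exp p q (- q * x * s)"
    using pq_Exp_scale[of "- x * s"] by (simp add: mult_ac)
  then have Exp: "complex_of_real (pq_Exp p q (- p * x * s))
      = (1 - of_real ((p - q) * s) * of_real x) * of_real (pq_Exp p q (- q * x * s))"
    by simp
  have "x > 0"
    unfolding x_def by (rule pq_node_pos)
  then show ?thesis
    unfolding laplace_primitive_def laplace_term_def x_def[symmetric] Exp
    by (simp add: field_simps)
qed

lemma laplace_primitive_Suc_eq:
  "laplace_primitive a s (j + 1)
     = (of_real (1 / pq_node p q j) - \<i> * of_real ((p - q) * a / p)) * laplace_term a s j"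
proof -
  define x where "x = pq_node p q j"
  define y where "y = pq_node p q (j + 1)"
  have y: "y = q * x / p"
    using pq_node_Suc[of j] p by (simp add: x_def y_def field_simps)
  \<comment> \<open>The factor of the functional equation at \<open>- \<i> * a * x / p\<close>,
    whose multiples by \<open>p\<close> and \<open>q\<close> are the arguments belonging to
    \<open>x\<close> and \<open>y\<close>.\<close>
  define K where "K = 1 - \<i> * of_real ((p - q) * a / p) * x"
  have Ex: "pq_cExp p q (- \<i> * of_real (a * x)) = K * pq_cExp p q (- \<i> * of_real (a * y))"
    using pq_cExp_scale[of "- \<i> * of_real (a * x / p)"] p by (simp add: y K_def mult_ac)
  \<comment> \<open>As \<open>K\<close> divides this value, it follows that \<open>K\<close> is
    nonzero and cancels after inversion.\<close>
  have "pq_cExp p q (- \<i> * of_real (a * x)) \<noteq> 0"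
    by (rule pq_cExp_nonzero) simp
  then have cis: "pq_cis (of_real (a * y)) = K * pq_cis (of_real (a * x))"
    unfolding pq_cis_def Ex by simp
  \<comment> \<open>The kernel with \<open>p\<close> at the next node is the kernel with
    \<open>q\<close> at the present one.\<close>
  have node: "- p * y * s = - q * x * s"
    using p by (simp add: y)
  have "x > 0"
    unfolding x_def by (rule pq_node_pos)
  then show ?thesis
    unfolding laplace_primitive_def laplace_term_def x_def[symmetric] y_def[symmetric] cis node
    by (simp add: K_def field_simps)
qed

lemma LIMSEQ_laplace_primitive: "(\<lambda>n. laplace_primitive a s (int n)) \<longlonglongrightarrow> 1"
proof -
  have lim: "(\<lambda>n. pq_cExp p q (c * of_real (pq_node p q (int n)))) \<longlonglongrightarrow> 1" for c
  proof -
    have "(\<lambda>n. c * complex_of_real (pq_node p q (int n))) \<longlonglongrightarrow> c * of_real 0"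
      by (intro tendsto_intros LIMSEQ_pq_node)
    then show ?thesis
      using isCont_tendsto_compose[OF isCont_pq_cExp[of 0]] by simp
  qed
  have "(\<lambda>n. inverse (pq_cExp p q (- \<i> * a * of_real (pq_node p q (int n)))) *
      pq_cExp p q (of_real (- p * s) * of_real (pq_node p q (int n)))) \<longlonglongrightarrow> inverse 1 * 1"
    by (intro tendsto_intros lim) simp
  then show ?thesis
    unfolding laplace_primitive_def[abs_def] pq_cis_def pq_cExp_of_real[symmetric]
    by (simp add: mult_ac)
qed

text \<open>
  Both expressions for the primitive at the same node give a recurrence for the terms. In the limit
  it exchanges their real and imaginary parts, so that one tends to 0 as soon as the other does.
\<close>

lemma laplace_term_recurrence:
  "(of_real (1 / pq_node p q (- int (Suc n))) - \<i> * of_real ((p - q) * a / p))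
      * laplace_term a s (- int (Suc n))
   = (of_real (1 / pq_node p q (- int n)) - of_real ((p - q) * s)) * laplace_term a s (- int n)"
  using laplace_primitive_eq[of a s "- int n"] laplace_primitive_Suc_eq[of a s "- int (Suc n)"]
  by simp

lemma laplace_term_tendsto_0_if_Re:
  assumes Re: "(\<lambda>n. Re (laplace_term a s (- int n))) \<longlonglongrightarrow> 0"
  shows "(\<lambda>n. laplace_term a s (- int n)) \<longlonglongrightarrow> 0"
proof -
  define u where "u n = laplace_term a s (- int n)" for n
  define y where "y n = 1 / pq_node p q (- int n)" for n
  define b where "b = (p - q) * a / p"
  have "(\<lambda>n. Im (u n)) \<longlonglongrightarrow> 0"
  \<comment> \<open>For \<open>a = 0\<close> the coefficient \<open>b\<close> of the imaginary part
    in the recurrence vanishes, but then all terms are real.\<close>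
  proof (cases "a = 0")
    case True
    then have "u n = of_real (pq_node p q (- int n) * pq_Exp p q (- q * pq_node p q (- int n) * s))" for n
      by (simp add: u_def laplace_term_def pq_cis_def)
    then show ?thesis by simp
  next
    case False
    then have "b \<noteq> 0"
      using p qp by (simp add: b_def)
    \<comment> \<open>The real part of the recurrence: the factor \<open>- \<i> * b\<close> turns
      the imaginary part of \<open>u (Suc n)\<close> into a real contribution. All other summands
      contain a real part of \<open>u\<close>, with coefficients that converge because
      \<open>y\<close> tends to 0.\<close>
    have "b * Im (u (Suc n)) = (y n - (p - q) * s) * Re (u n) - y (Suc n) * Re (u (Suc n))" for n
      using arg_cong[OF laplace_term_recurrence[of n a s], of Re]
      unfolding u_def[symmetric] y_def[symmetric] b_def[symmetric] by (simp add: algebra_simps)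
    then have "Im (u (Suc n)) = ((y n - (p - q) * s) * Re (u n) - y (Suc n) * Re (u (Suc n))) / b" for n
      using \<open>b \<noteq> 0\<close> by (simp add: field_simps)
    moreover have "(\<lambda>n. ((y n - (p - q) * s) * Re (u n) - y (Suc n) * Re (u (Suc n))) / b)
        \<longlonglongrightarrow> ((0 - (p - q) * s) * 0 - 0 * 0) / b"
      using Re LIMSEQ_inverse_pq_node
      by (intro tendsto_intros \<open>b \<noteq> 0\<close>; unfold u_def y_def)
        (auto intro: LIMSEQ_Suc simp del: of_nat_Suc)
    ultimately show ?thesis
      by (subst filterlim_sequentially_Suc[symmetric]) simp
  qed
  with Re show ?thesis
    unfolding u_def by (simp add: tendsto_complex_iff)
qed

text \<open>The counterpart with imaginary parts of the recurrence. For \<open>a = 0\<close> the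
  terms are real, so their imaginary parts would say nothing about them.\<close>

lemma laplace_term_tendsto_0_if_Im:
  assumes Im: "(\<lambda>n. Im (laplace_term a s (- int n))) \<longlonglongrightarrow> 0" and "a \<noteq> 0"
  shows "(\<lambda>n. laplace_term a s (- int n)) \<longlonglongrightarrow> 0"
proof -
  define u where "u n = laplace_term a s (- int n)" for n
  define y where "y n = 1 / pq_node p q (- int n)" for n
  define b where "b = (p - q) * a / p"
  have "b \<noteq> 0"
    using p qp \<open>a \<noteq> 0\<close> by (simp add: b_def)
  have "b * Re (u (Suc n)) = y (Suc n) * Im (u (Suc n)) - (y n - (p - q) * s) * Im (u n)" for n
    using arg_cong[OF laplace_term_recurrence[of n a s], of Im]
    unfolding u_def[symmetric] y_def[symmetric] b_def[symmetric] by (simp add: algebra_simps)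
  then have "Re (u (Suc n)) = (y (Suc n) * Im (u (Suc n)) - (y n - (p - q) * s) * Im (u n)) / b" for n
    using \<open>b \<noteq> 0\<close> by (simp add: field_simps)
  moreover have "(\<lambda>n. (y (Suc n) * Im (u (Suc n)) - (y n - (p - q) * s) * Im (u n)) / b)
      \<longlonglongrightarrow> (0 * 0 - (0 - (p - q) * s) * 0) / b"
    using Im LIMSEQ_inverse_pq_node
    by (intro tendsto_intros \<open>b \<noteq> 0\<close>; unfold u_def y_def)
      (auto intro: LIMSEQ_Suc simp del: of_nat_Suc)
  ultimately have "(\<lambda>n. Re (u n)) \<longlonglongrightarrow> 0"
    by (subst filterlim_sequentially_Suc[symmetric]) simp
  with Im show ?thesis
    unfolding u_def by (simp add: tendsto_complex_iff)
qed

lemma laplace_partial_sums: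
  assumes "s > 0" and lim: "(\<lambda>n. laplace_term a s (- int n)) \<longlonglongrightarrow> 0"
  shows "(\<lambda>n. \<Sum>j\<in>{- int n..<int n}. of_real (p - q) * laplace_term a s j)
    \<longlonglongrightarrow> Complex (p\<^sup>2 * s / ((p * s)\<^sup>2 + a\<^sup>2)) (p * a / ((p * s)\<^sup>2 + a\<^sup>2))"
proof -
  \<comment> \<open>This is \<open>s - \<i> * a / p\<close>, the constant between the differences of
    the primitive and the terms scaled by \<open>p - q\<close>. Its reciprocal has the two claimed
    values as real and imaginary part.\<close>
  define k where "k = Complex s (- a / p)"
  have "k \<noteq> 0"
    using \<open>s > 0\<close> by (simp add: k_def complex_eq_iff)
  have k: "k * of_real (p - q) = of_real ((p - q) * s) - \<i> * of_real ((p - q) * a / p)"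
    by (simp add: k_def complex_eq_iff)
  have step: "laplace_primitive a s (j + 1) - laplace_primitive a s j = k * (of_real (p - q) * laplace_term a s j)" for j
    unfolding mult.assoc[symmetric] k laplace_primitive_eq[of a s j] laplace_primitive_Suc_eq
    by (simp only: left_diff_distrib) simp
  have "k * (\<Sum>j\<in>{- int n..<int n}. of_real (p - q) * laplace_term a s j)
      = laplace_primitive a s (int n) - laplace_primitive a s (- int n)" for n
    unfolding sum_distrib_left step[symmetric] by (rule sum_int_telescope)
  then have eq: "(\<Sum>j\<in>{- int n..<int n}. of_real (p - q) * laplace_term a s j)
      = (laplace_primitive a s (int n) - laplace_primitive a s (- int n)) / k" for n
    using \<open>k \<noteq> 0\<close> by (metis nonzero_mult_div_cancel_left)
  \<comment> \<open>At the far end the primitive is a term times a factor tending to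
    \<open>- (p - q) * s\<close>, so it vanishes along with the terms.\<close>
  have "(\<lambda>n. (of_real (1 / pq_node p q (- int n)) - of_real ((p - q) * s)) * laplace_term a s (- int n))
      \<longlonglongrightarrow> (of_real 0 - of_real ((p - q) * s)) * 0"
    by (intro tendsto_intros LIMSEQ_inverse_pq_node lim)
  then have "(\<lambda>n. laplace_primitive a s (- int n)) \<longlonglongrightarrow> 0"
    unfolding laplace_primitive_eq by simp
  then have "(\<lambda>n. (laplace_primitive a s (int n) - laplace_primitive a s (- int n)) / k) \<longlonglongrightarrow> (1 - 0) / k"
    by (intro tendsto_intros LIMSEQ_laplace_primitive \<open>k \<noteq> 0\<close>)
  moreover have "(p * s)\<^sup>2 + a\<^sup>2 > 0"
    using p \<open>s > 0\<close> by (simp add: add_pos_nonneg)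
  then have "(1 - 0) / k = Complex (p\<^sup>2 * s / ((p * s)\<^sup>2 + a\<^sup>2)) (p * a / ((p * s)\<^sup>2 + a\<^sup>2))"
    using p by (simp add: k_def complex_eq_iff Re_divide Im_divide field_simps power2_eq_square)
  ultimately show ?thesis
    unfolding eq by simp
qed

section \<open>Evaluation of the two transforms\<close>

lemma pq_laplace_cos_eq:
  assumes "s > 0" and ex: "pq_laplace_exists p q (\<lambda>t. pq_cos p q (a * t)) s"
  shows "pq_laplace p q (\<lambda>t. pq_cos p q (a * t)) s = p\<^sup>2 * s / ((p * s)\<^sup>2 + a\<^sup>2)"
proof -
  have term_eq: "pq_node p q j * (pq_cos p q (a * pq_node p q j) * pq_Exp p q (- q * pq_node p q j * s))
      = Re (laplace_term a s j)" for j
    by (simp add: laplace_term_def pq_cos_eq)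
  have sm: "(\<lambda>j. Re (laplace_term a s j)) summable_on UNIV"
    using ex unfolding pq_laplace_exists_def pq_integrable_def pq_node_def[symmetric] term_eq .
  \<comment> \<open>Existence of the transform enters twice: it lets the sum be computed along
    symmetric intervals, and it makes the real parts of the terms vanish at the far nodes.\<close>
  have "(\<lambda>n. \<Sum>j\<in>{- int n..<int n}. (p - q) * Re (laplace_term a s j))
      \<longlonglongrightarrow> (p - q) * (\<Sum>\<^sub>\<infinity>j. Re (laplace_term a s j))"
    by (intro has_sum_int_imp_LIMSEQ has_sum_cmult_right has_sum_infsum sm)
  moreover have "(\<lambda>n. \<Sum>j\<in>{- int n..<int n}. (p - q) * Re (laplace_term a s j))
      \<longlonglongrightarrow> p\<^sup>2 * s / ((p * s)\<^sup>2 + a\<^sup>2)"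
    using tendsto_Re[OF laplace_partial_sums[OF \<open>s > 0\<close> laplace_term_tendsto_0_if_Re[OF summable_on_int_imp_LIMSEQ_neg[OF sm]]]]
    by simp
  ultimately show ?thesis
    unfolding pq_laplace_def pq_integral_def pq_node_def[symmetric] term_eq
    by (rule LIMSEQ_unique)
qed

lemma pq_laplace_sin_eq:
  assumes "s > 0" and ex: "pq_laplace_exists p q (\<lambda>t. pq_sin p q (a * t)) s"
  shows "pq_laplace p q (\<lambda>t. pq_sin p q (a * t)) s = p * a / ((p * s)\<^sup>2 + a\<^sup>2)"
proof (cases "a = 0")
  \<comment> \<open>Here the sine factor is the imaginary part of \<open>pq_cis 0 = 1\<close>, so
    both sides are 0.\<close>
  case True
  then show ?thesis
    by (simp add: pq_laplace_def pq_integral_def pq_sin_eq pq_cis_def)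
next
  case False
  have term_eq: "pq_node p q j * (pq_sin p q (a * pq_node p q j) * pq_Exp p q (- q * pq_node p q j * s))
      = Im (laplace_term a s j)" for j
    by (simp add: laplace_term_def pq_sin_eq)
  have sm: "(\<lambda>j. Im (laplace_term a s j)) summable_on UNIV"
    using ex unfolding pq_laplace_exists_def pq_integrable_def pq_node_def[symmetric] term_eq .
  have "(\<lambda>n. \<Sum>j\<in>{- int n..<int n}. (p - q) * Im (laplace_term a s j))
      \<longlonglongrightarrow> (p - q) * (\<Sum>\<^sub>\<infinity>j. Im (laplace_term a s j))"
    by (intro has_sum_int_imp_LIMSEQ has_sum_cmult_right has_sum_infsum sm)
  moreover have "(\<lambda>n. \<Sum>j\<in>{- int n..<int n}. (p - q) * Im (laplace_term a s j))
      \<longlonglongrightarrow> p * a / ((p * s)\<^sup>2 + a\<^sup>2)"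
    using tendsto_Im[OF laplace_partial_sums[OF \<open>s > 0\<close> laplace_term_tendsto_0_if_Im[OF summable_on_int_imp_LIMSEQ_neg[OF sm] False]]]
    by simp
  ultimately show ?thesis
    unfolding pq_laplace_def pq_integral_def pq_node_def[symmetric] term_eq
    by (rule LIMSEQ_unique)
qed

end

theorem theorem3p6:
  fixes p q a s :: real
  assumes "0 < q" and "q < p" and "s > 0"
  shows "(pq_laplace_exists p q (\<lambda>t. pq_cos p q (a * t)) s \<longrightarrow>
            pq_laplace p q (\<lambda>t. pq_cos p q (a * t)) s = p\<^sup>2 * s / ((p * s)\<^sup>2 + a\<^sup>2)) \<and>
         (pq_laplace_exists p q (\<lambda>t. pq_sin p q (a * t)) s \<longrightarrow>
            pq_laplace p q (\<lambda>t. pq_sin p q (a * t)) s = p * a / ((p * s)\<^sup>2 + a\<^sup>2))"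
  using pq_laplace_cos_eq pq_laplace_sin_eq assms by blast

end
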